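(* Let $\gamma=\frac{1+\sqrt5}2$ and $T:[0,1)^2\to[0,1)^2$, $T(x,y)=(y,\{-x+y/\gamma\})$. Then $\pi(z)$ is finite for all points $z\in(\mathbb Z[\gamma]\cap[0,1))^2$, but $(T^k(0,1/3))_{k\in\mathbb Z}$ is aperiodic.
   Context: $\{u\}=u-\lfloor u\rfloor$ is the fractional part. $T$ is a bijection of $[0,1)^2$. $\pi(z)$ is the least $p\ge1$ with $T^p(z)=z$, and $\pi(z)=\infty$ (the sequence $(T^k(z))_{k\in\mathbb Z}$ is aperiodic) if no such $p$ exists. *)

theory Defs
  imports Complex_Main "HOL-Library.Extended_Nat" "HOL-Computational_Algebra.Polynomial"
begin

definition golden :: real where
  "golden = (1 + sqrt 5) / 2"

text \<open>The ring \<open>\<int>[\<gamma>]\<close>: all values at \<open>\<gamma>\<close> of polynomials with integer coefficients.\<close>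

definition Z_golden :: "real set" where
  "Z_golden = {poly (map_poly of_int p) golden | p :: int poly. True}"

definition unit_square :: "(real \<times> real) set" where
  "unit_square = {0..<1} \<times> {0..<1}"

text \<open>The formula makes sense on the whole plane, but only the restriction to
  \<open>unit_square\<close>, which is a bijection onto \<open>unit_square\<close>
  (\<open>bij_betw_T\<close> below), is meant.\<close>

fun T :: "real \<times> real \<Rightarrow> real \<times> real" where
  "T (x, y) = (y, frac (- x + y / golden))"

text \<open>The power \<open>T\<^sup>k\<close> for an integer \<open>k\<close>; negative powers use the inverse
  of the bijection \<open>T\<close> of \<open>unit_square\<close>, so it is meaningful only on points
  of \<open>unit_square\<close>.\<close>

definition T_power :: "int \<Rightarrow> real \<times> real \<Rightarrow> real \<times> real" where
  "T_power k z =
    (if 0 \<le> k then (T ^^ nat k) z else (inv_into unit_square T ^^ nat (- k)) z)"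

definition period :: "real \<times> real \<Rightarrow> enat" where
  "period z =
    (if \<exists>p\<ge>1. (T ^^ p) z = z then enat (LEAST p. 1 \<le> p \<and> (T ^^ p) z = z) else \<infinity>)"

definition aperiodic :: "(int \<Rightarrow> 'a) \<Rightarrow> bool" where
  "aperiodic s \<longleftrightarrow> \<not> (\<exists>p\<ge>1. \<forall>k. s (k + p) = s k)"

lemma T_in_unit_square: "z \<in> unit_square \<Longrightarrow> T z \<in> unit_square"
  by (cases z) (auto simp: unit_square_def frac_lt_1)

lemma bij_betw_T: "bij_betw T unit_square unit_square"
proof (rule bij_betw_byWitness[where f' = "\<lambda>(u, v). (frac (u / golden - v), u)"])
  have frac_frac: "frac (a - frac b) = frac (a - b)" for a b :: real
  proof -
    have "a - frac b = (a - b) + of_int \<lfloor>b\<rfloor>" by (simp add: frac_def)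
    then show ?thesis by (metis frac_add_of_int_right)
  qed
  have frac_id: "frac a = a" if "0 \<le> a" "a < 1" for a :: real
    using that by (simp add: frac_eq)
  show "\<forall>z\<in>unit_square. (\<lambda>(u, v). (frac (u / golden - v), u)) (T z) = z"
    by (auto simp: unit_square_def frac_frac frac_id)
  show "\<forall>z\<in>unit_square. T ((\<lambda>(u, v). (frac (u / golden - v), u)) z) = z"
  proof safe
    fix u v :: real assume *: "(u, v) \<in> unit_square"
    have "frac (u / golden - frac (u / golden - v)) = v"
      using * by (simp add: frac_frac frac_id unit_square_def)
    then show "T (frac (u / golden - v), u) = (u, v)" by simp
  qed
  show "T ` unit_square \<subseteq> unit_square" using T_in_unit_square by blast
  show "(\<lambda>(u, v). (frac (u / golden - v), u)) ` unit_square \<subseteq> unit_square"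
    by (auto simp: unit_square_def frac_lt_1)
qed

lemma T_power_in_unit_square:
  assumes "z \<in> unit_square" shows "T_power k z \<in> unit_square"
proof -
  have "(T ^^ n) z \<in> unit_square" for n
    using assms by (induction n) (auto intro: T_in_unit_square)
  moreover have "(inv_into unit_square T ^^ n) z \<in> unit_square" for n
    using assms bij_betw_apply[OF bij_betw_inv_into[OF bij_betw_T]] by (induction n) auto
  ultimately show ?thesis by (simp add: T_power_def)
qed

lemma T_power_Suc:
  assumes "z \<in> unit_square" shows "T_power (k + 1) z = T (T_power k z)"
proof (cases "0 \<le> k")
  case True
  then show ?thesis by (simp add: T_power_def nat_add_distrib)
next
  case False
  define m where "m = nat (- (k + 1))"
  have k: "nat (- k) = Suc m" using False by (simp add: m_def)
  let ?w = "(inv_into unit_square T ^^ m) z"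
  have w: "?w = T_power (k + 1) z"
    using False by (auto simp: T_power_def m_def)
  then have "?w \<in> unit_square" using T_power_in_unit_square[OF assms] by simp
  then have "T (inv_into unit_square T ?w) = ?w"
    using bij_betw_inv_into_right[OF bij_betw_T] by blast
  then show ?thesis using False w k by (simp add: T_power_def)
qed

lemma aperiodic_iff_period_infinite:
  assumes z: "z \<in> unit_square"
  shows "aperiodic (\<lambda>k. T_power k z) \<longleftrightarrow> period z = \<infinity>"
proof -
  have "(\<exists>p\<ge>1. \<forall>k. T_power (k + p) z = T_power k z) \<longleftrightarrow> (\<exists>p\<ge>1. (T ^^ p) z = z)"
  proof
    assume "\<exists>p\<ge>1. \<forall>k. T_power (k + p) z = T_power k z"
    then obtain p where p: "p \<ge> 1" "\<forall>k. T_power (k + p) z = T_power k z" by blast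
    from p(2) have "T_power (0 + p) z = T_power 0 z" by blast
    with p(1) have "(T ^^ nat p) z = z" "nat p \<ge> 1" by (simp_all add: T_power_def)
    then show "\<exists>p\<ge>1. (T ^^ p) z = z" by blast
  next
    assume "\<exists>p\<ge>1. (T ^^ p) z = z"
    then obtain p where p: "p \<ge> 1" "(T ^^ p) z = z" by blast
    have "T_power (k + int p) z = T_power k z" for k
    proof (induction k rule: int_induct[where k = 0])
      case base
      show ?case using p by (simp add: T_power_def)
    next
      case (step1 i)
      then show ?case
        using T_power_Suc[OF z, of "i + int p"] T_power_Suc[OF z, of i] by (simp add: ac_simps)
    next
      case (step2 i)
      have "T (T_power (i - 1 + int p) z) = T (T_power (i - 1) z)"
        using T_power_Suc[OF z, of "i - 1 + int p"] T_power_Suc[OF z, of "i - 1"] step2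
        by (simp add: algebra_simps)
      then show ?case
        using bij_betw_imp_inj_on[OF bij_betw_T] T_power_in_unit_square[OF z]
        by (meson inj_onD)
    qed
    moreover have "int p \<ge> 1" using p(1) by simp
    ultimately show "\<exists>p\<ge>1. \<forall>k. T_power (k + p) z = T_power k z" by blast
  qed
  then show ?thesis by (simp add: aperiodic_def period_def)
qed

end

theory Submission
  imports Defs
begin

text \<open>
  The linear part of \<open>T\<close> has order five: it is the rotation by \<open>2\<pi>/5\<close> for a suitable quadratic
  form. Hence \<open>T\<close> is a piecewise rotation of the square, with one piece on either side of the line
  \<open>y = \<gamma>x\<close>. The dynamics is self-similar with scaling factor \<open>\<gamma>\<^sup>2\<close>. To see this, consider the
  triangle above the line \<open>y = \<gamma>x\<close>. The first return of \<open>T\<close> to it is a map \<open>return_map\<close>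
  with two pieces, rotated by \<open>rot2\<close> (return time two) and \<open>rot3\<close> (return time three).
  Write \<open>a\<close> and \<open>b\<close> for these pieces. The first return to the triangle scaled by
  \<open>1/\<gamma>\<^sup>2\<close> is \<open>return_map\<close> again, up to scaling, with the itinerary \<open>aba\<close> in place of \<open>a\<close>
  and \<open>abbba\<close> in place of \<open>b\<close> (\<open>shrink_return\<close>).

  An orbit that avoids both the triangle and the origin repeats the rotation \<open>rot1\<close> and
  is periodic, and the origin is fixed, so only points of the triangle matter.
  Self-similarity gives a renormalization for them: follow a point until it enters the small triangle, then
  magnify by \<open>\<gamma>\<^sup>2\<close>. A point of the triangle that never enters the small triangle repeats one rotation five
  times and is periodic (\<open>reaches_small\<close>). Magnification preserves periodicity in both directions
  and strictly decreases the period (\<open>return_descent\<close>, \<open>return_map_pow_shrink\<close>).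

  The point \<open>(0, 1/3)\<close> is periodic under renormalization. If it were periodic under \<open>T\<close>, its
  period would have to decrease around this cycle, which is impossible (\<open>third_not_periodic\<close>).

  For points of \<open>\<int>[\<gamma>]\<^sup>2\<close> apply the Galois conjugation to the coordinates. The conjugate of
  \<open>T\<close> is again a rotation followed by a bounded translation, so the short path to the
  small triangle changes the size of the conjugate point by a bounded amount, whereas magnification by
  \<open>\<gamma>\<^sup>2\<close> divides that size by \<open>\<gamma>\<^sup>2\<close> (\<open>height_reduction\<close>). Renormalization therefore
  ends at a periodic point or among the few points of \<open>\<int>[\<gamma>]\<^sup>2\<close> in the triangle with small
  conjugates. There are only three of these and all are periodic (\<open>pentagon_points\<close>).
\<close>

section \<open>The golden ratio\<close>

lemma golden_square: "golden * golden = golden + 1"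
  by (simp add: golden_def field_simps)

lemma golden_mult_golden: "golden * (golden * x) = golden * x + x"
  using golden_square by (simp add: mult.assoc[symmetric] algebra_simps)

lemma golden_bounds: "1.618 < golden" "golden < 1.6181"
proof -
  have "2.236 < sqrt 5" by (rule real_less_rsqrt) (simp add: power2_eq_square)
  moreover have "sqrt 5 < 2.2362" by (rule real_less_lsqrt) (simp_all add: power2_eq_square)
  ultimately show "1.618 < golden" "golden < 1.6181" by (simp_all add: golden_def)
qed

lemma divide_golden: "x / golden = golden * x - x"
  using golden_mult_golden[of x] golden_bounds by (simp add: field_simps)

text \<open>Both sides of an identity or inequality that is affine in \<open>x\<close>, \<open>y\<close> over
  \<open>\<int>[\<gamma>]\<close> are brought to integer combinations of \<open>1\<close>, \<open>golden\<close>, \<open>x\<close>, \<open>y\<close>,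
  \<open>golden * x\<close>, \<open>golden * y\<close>, so that identities become trivial and inequalities become
  linear arithmetic in these six quantities. Throughout, \<open>1/\<gamma>\<close> is written \<open>golden - 1\<close> and
  \<open>1/\<gamma>\<^sup>2\<close> is written \<open>2 - golden\<close>.\<close>
lemmas golden_simps = golden_square golden_mult_golden divide_golden algebra_simps

lemma golden_pos: "0 < golden"
  using golden_bounds by simp

text \<open>Linear arithmetic treats \<open>golden * x\<close> and \<open>x\<close> as unrelated. An inequality that follows
  from some \<open>0 \<le> h\<close> by combining them with nonnegative coefficients in \<open>\<int>[\<gamma>]\<close> can
  be found once a few positive elements of \<open>\<int>[\<gamma>]\<close> have been multiplied into each \<open>h\<close>; the
  powers \<open>\<gamma>\<close>, \<open>\<gamma>\<^sup>-\<^sup>1\<close>, \<open>\<gamma>\<^sup>-\<^sup>2\<close>, \<open>\<gamma>\<^sup>-\<^sup>3\<close> are enough here.\<close>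
lemma golden_multiples:
  assumes "0 \<le> h"
  shows "0 \<le> (golden - 1) * h" "0 \<le> (2 - golden) * h" "0 \<le> (2 * golden - 3) * h"
    "0 \<le> golden * h"
  using assms golden_bounds by simp_all

section \<open>The first return to a triangle\<close>

declare T.simps [simp del]

text \<open>This is the part of the square on which \<open>T\<close> is linear. Its vertex \<open>(0, 0)\<close> is left out
  because it is fixed by \<open>T\<close>, whereas all other points leave the triangle at once.\<close>
definition triangle :: "(real \<times> real) set" where
  "triangle = {(x, y). 0 \<le> x \<and> golden * x \<le> y \<and> 0 < y \<and> y < 1}"

text \<open>The line \<open>\<gamma>y - x = 1\<close> separates the points that come back to the triangle after two steps
  (on or below it) from those that need three.\<close>
fun low :: "real \<times> real \<Rightarrow> bool" where
  "low (x, y) \<longleftrightarrow> golden * y - x \<le> 1"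

text \<open>On each piece where it is affine, a power of \<open>T\<close> is a rotation by a multiple of \<open>2\<pi>/5\<close>
  with respect to the quadratic form \<open>x\<^sup>2 - xy/\<gamma> + y\<^sup>2\<close>. The maps \<open>rot1\<close>, \<open>rot2\<close>, \<open>rot3\<close>
  are the formulas for \<open>T\<close>, \<open>T\<^sup>2\<close>, \<open>T\<^sup>3\<close> on the pieces where the integers added by the
  fractional parts are \<open>1\<close>, respectively \<open>0, 1\<close> and \<open>0, 1, 1\<close>. Each of the three has order five.\<close>
fun rot1 :: "real \<times> real \<Rightarrow> real \<times> real" where
  "rot1 (x, y) = (y, (golden - 1) * y - x + 1)"

fun rot2 :: "real \<times> real \<Rightarrow> real \<times> real" where
  "rot2 (x, y) = ((golden - 1) * y - x, 1 - (golden - 1) * (x + y))"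

fun rot3 :: "real \<times> real \<Rightarrow> real \<times> real" where
  "rot3 (x, y) = (1 - (golden - 1) * (x + y), golden + (golden - 1) * x - y)"

definition return_map :: "real \<times> real \<Rightarrow> real \<times> real" where
  "return_map z = (if low z then rot2 z else rot3 z)"

lemma rot1_pow5: "rot1 (rot1 (rot1 (rot1 (rot1 z)))) = z"
  by (cases z) (simp add: golden_simps)

lemma rot2_pow5: "rot2 (rot2 (rot2 (rot2 (rot2 z)))) = z"
  by (cases z) (simp add: golden_simps)

lemma rot3_pow5: "rot3 (rot3 (rot3 (rot3 (rot3 z)))) = z"
  by (cases z) (simp add: golden_simps)

lemma funpow_5: "(f ^^ 5) z = f (f (f (f (f z))))"
  by (simp add: eval_nat_numeral)

lemma mult_less_one: "0 \<le> a \<Longrightarrow> a < 1 \<Longrightarrow> 0 \<le> b \<Longrightarrow> b < 1 \<Longrightarrow> a * b < (1::real)"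
  using mult_strict_mono[of a 1 b 1] by simp

text \<open>Since \<open>-x + y/\<gamma>\<close> lies strictly between \<open>-1\<close> and \<open>1\<close>, the fractional part adds
  either \<open>0\<close> or \<open>1\<close>, and which one is decided by the line \<open>y = \<gamma>x\<close>.\<close>
lemma T_cases:
  assumes "0 \<le> x" "x < 1" "0 \<le> y" "y < 1"
  shows "T (x, y) = (if golden * x \<le> y then (y, (golden - 1) * y - x)
                     else (y, (golden - 1) * y - x + 1))"
proof -
  let ?t = "(golden - 1) * y - x"
  have t: "T (x, y) = (y, frac ?t)" by (simp add: T.simps golden_simps)
  have iff: "golden * x \<le> y \<longleftrightarrow> 0 \<le> ?t"
  proof -
    have "y - golden * x = golden * ?t" by (simp add: golden_simps)
    then have "0 \<le> y - golden * x \<longleftrightarrow> 0 \<le> ?t"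
      using golden_pos by (simp only: zero_le_mult_iff) auto
    then show ?thesis by simp
  qed
  have "(golden - 1) * y < 1"
    using assms golden_bounds by (intro mult_less_one) simp_all
  moreover have "0 \<le> (golden - 1) * y" using assms golden_bounds by simp
  ultimately have b: "?t < 1" "-1 < ?t" using assms by simp_all
  show ?thesis
  proof (cases "golden * x \<le> y")
    case True
    then show ?thesis using b iff t by (simp add: frac_eq)
  next
    case False
    then have "frac (?t + 1) = ?t + 1" using b iff by (simp add: frac_eq)
    then have "frac ?t = ?t + 1" by (metis frac_1_eq)
    then show ?thesis using False t by simp
  qed
qed

lemma triangle_in_unit_square: "z \<in> triangle \<Longrightarrow> z \<in> unit_square"
proof (cases z)
  case (Pair x y)
  assume "z \<in> triangle"
  then have h: "0 \<le> x" "golden * x \<le> y" "y < 1" using Pair by (auto simp: triangle_def)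
  have "1 * x \<le> golden * x" using h golden_bounds by (intro mult_right_mono) simp_all
  then have "x < 1" "0 \<le> y" using h golden_bounds by simp_all
  then show ?thesis using h Pair by (simp add: unit_square_def)
qed

text \<open>A point whose orbit avoids both the origin and the triangle only ever undergoes \<open>rot1\<close>,
  which has order five.\<close>
lemma origin_or_triangle_or_rot1:
  assumes "z \<in> unit_square"
  obtains "z = (0, 0)" | "z \<in> triangle" | "T z = rot1 z"
proof -
  obtain x y where z: "z = (x, y)" by (cases z)
  have xy: "0 \<le> x" "x < 1" "0 \<le> y" "y < 1" using assms z by (auto simp: unit_square_def)
  show ?thesis
  proof (cases "golden * x \<le> y")
    case False
    then show ?thesis using that(3) T_cases[OF xy] z by simp
  next
    case True
    show ?thesis
    proof (cases "y = 0")
      case y: True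
      then have "golden * x \<le> 0" using True by simp
      then have "x = 0" using golden_pos xy by (simp add: mult_le_0_iff)
      then show ?thesis using that(1) z y by simp
    next
      case False
      then show ?thesis using that(2) True xy z by (simp add: triangle_def)
    qed
  qed
qed

text \<open>A point of the triangle is first carried below the line \<open>y = \<gamma>x\<close>, and it is back
  above that line after two or after three steps.\<close>
lemma T_steps_in_triangle:
  assumes "z \<in> triangle"
  shows "T z \<notin> triangle" and "T (T z) = rot2 z"
    and "\<not> low z \<Longrightarrow> rot2 z \<notin> triangle" and "\<not> low z \<Longrightarrow> T (rot2 z) = rot3 z"
proof -
  obtain x y where z: "z = (x, y)" by (cases z)
  have h: "0 \<le> x" "0 \<le> y - golden * x" "0 < y" "y < 1"
    using assms z by (auto simp: triangle_def)
  have xy: "0 \<le> x" "x < 1" "0 \<le> y" "y < 1"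
    using triangle_in_unit_square[OF assms] z by (auto simp: unit_square_def)
  let ?w = "(golden - 1) * y - x"
  have T1: "T z = (y, ?w)" using T_cases[OF xy] h z by simp
  have "0 \<le> (golden - 1) * (y - golden * x)" using h golden_bounds by simp
  then have w0: "0 \<le> ?w" by (simp add: golden_simps)
  have "(golden - 1) * y < 1 * y" using h golden_bounds by (intro mult_strict_right_mono) simp_all
  then have w1: "?w < y" using h by linarith
  have "1 * y \<le> golden * y" using h golden_bounds by (intro mult_right_mono) simp_all
  then have ny: "\<not> golden * y \<le> ?w" using w1 by linarith
  show "T z \<notin> triangle" using ny T1 by (simp add: triangle_def)
  have "T (y, ?w) = (?w, (golden - 1) * ?w - y + 1)"
    using T_cases[of y ?w] ny w0 w1 xy by simp
  then show T2: "T (T z) = rot2 z" using T1 z by (simp add: golden_simps)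
  assume nl: "\<not> low z"
  then have nl': "0 < golden * y - x - 1" using z by simp
  show "rot2 z \<notin> triangle" using nl' z by (simp add: triangle_def golden_simps)
  have sq: "rot2 z \<in> unit_square"
    using triangle_in_unit_square[OF assms] T_in_unit_square T2 by metis
  have "\<not> golden * fst (rot2 z) \<le> snd (rot2 z)"
    using nl' z by (simp add: golden_simps)
  then have "T (rot2 z) = (snd (rot2 z), (golden - 1) * snd (rot2 z) - fst (rot2 z) + 1)"
    using T_cases[of "fst (rot2 z)" "snd (rot2 z)"] sq by (simp add: unit_square_def mem_Times_iff)
  then show "T (rot2 z) = rot3 z" using z by (simp add: golden_simps)
qed

lemma return_map_in_triangle:
  assumes "z \<in> triangle" shows "return_map z \<in> triangle"
proof (cases z)
  case (Pair x y)
  have h: "0 \<le> x" "0 \<le> y - golden * x" "0 < y" "y < 1"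
    using assms Pair by (auto simp: triangle_def)
  \<comment> \<open>This affine function vanishes at the excluded corner \<open>(1/\<gamma>, 1)\<close>, hence is a nonnegative
    combination of the sides through that corner.\<close>
  have Y: "0 < 1 - (golden - 1) * (x + y)"
  proof -
    have "0 < (1 - y) + (2 - golden) * (y - golden * x)"
      using h golden_bounds by (intro add_pos_nonneg mult_nonneg_nonneg) simp_all
    then show ?thesis by (simp add: golden_simps)
  qed
  show ?thesis
  proof (cases "low z")
    case True
    have "0 \<le> (golden - 1) * (y - golden * x)" "0 < (golden - 1) * (x + y)"
      using h golden_bounds by simp_all
    then show ?thesis
      using True Pair Y by (simp add: return_map_def triangle_def golden_simps)
  next
    case False
    then have "0 < (golden - 1) * (golden * y - x - 1)"
      using Pair golden_bounds by simp
    moreover have "0 < golden * (1 - (golden - 1) * (x + y))" "0 \<le> golden * x"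
      using Y golden_bounds h by simp_all
    ultimately show ?thesis
      using False Pair Y by (simp add: return_map_def triangle_def golden_simps)
  qed
qed

lemma return_map_pow_in_triangle: "z \<in> triangle \<Longrightarrow> (return_map ^^ n) z \<in> triangle"
  by (induction n) (auto intro: return_map_in_triangle)

text \<open>Together with \<open>return_map_pow_eq_T_pow\<close> this allows periodicity under \<open>T\<close> to be
  studied through the return map.\<close>
lemma T_pow_eq_return_map_pow:
  assumes "z \<in> triangle" "1 \<le> p" "(T ^^ p) z \<in> triangle"
  shows "\<exists>n\<ge>1. (T ^^ p) z = (return_map ^^ n) z"
  using assms
proof (induction p arbitrary: z rule: less_induct)
  case (less p)
  note t = T_steps_in_triangle[OF less.prems(1)]
  have step: "\<exists>n\<ge>1. (T ^^ p) z = (return_map ^^ n) z"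
    if "(T ^^ k) z = return_map z" "1 \<le> k" "k \<le> p" for k
  proof -
    have eq: "(T ^^ p) z = (T ^^ (p - k)) (return_map z)"
      using that by (metis funpow_add o_apply le_add_diff_inverse2)
    show ?thesis
    proof (cases "p = k")
      case True
      then show ?thesis using that by (intro exI[of _ 1]) simp
    next
      case False
      have "p - k < p" "1 \<le> p - k" using that False by auto
      then obtain n where "n \<ge> 1" "(T ^^ (p - k)) (return_map z) = (return_map ^^ n) (return_map z)"
        using less.IH[of "p - k" "return_map z"] return_map_in_triangle[OF less.prems(1)]
          less.prems(3) eq
        by auto
      then show ?thesis using eq by (intro exI[of _ "Suc n"]) (simp add: funpow_swap1)
    qed
  qed
  have "p \<noteq> 1" using t(1) less.prems(3) by auto
  then have p2: "2 \<le> p" using less.prems(2) by simp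
  show ?case
  proof (cases "low z")
    case True
    then have "(T ^^ 2) z = return_map z" using t(2) by (simp add: numeral_2_eq_2 return_map_def)
    then show ?thesis using step[of 2] p2 by simp
  next
    case False
    then have "p \<noteq> 2" using t(2,3) less.prems(3) by (auto simp: numeral_2_eq_2)
    moreover have "(T ^^ 3) z = return_map z"
      using t(2,4) False by (simp add: numeral_3_eq_3 return_map_def)
    ultimately show ?thesis using step[of 3] p2 by simp
  qed
qed

lemma return_map_pow_eq_T_pow:
  assumes "z \<in> triangle"
  shows "\<exists>m\<ge>n. (return_map ^^ n) z = (T ^^ m) z"
proof (induction n)
  case (Suc n)
  then obtain m where m: "m \<ge> n" "(return_map ^^ n) z = (T ^^ m) z" by blast
  let ?v = "(return_map ^^ n) z"
  note t = T_steps_in_triangle[OF return_map_pow_in_triangle[OF assms, of n]]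
  have "return_map ?v = (T ^^ 2) ?v \<or> return_map ?v = (T ^^ 3) ?v"
    using t by (auto simp: numeral_2_eq_2 numeral_3_eq_3 return_map_def)
  then obtain k where "k \<ge> 1" "return_map ?v = (T ^^ k) ?v" by (metis one_le_numeral)
  then show ?case using m by (intro exI[of _ "k + m"]) (auto simp: funpow_add)
qed (auto intro: exI[of _ 0])

section \<open>Periodic points\<close>

definition T_periodic :: "real \<times> real \<Rightarrow> bool" where
  "T_periodic z \<longleftrightarrow> (\<exists>p\<ge>1. (T ^^ p) z = z)"

definition return_periodic :: "real \<times> real \<Rightarrow> bool" where
  "return_periodic z \<longleftrightarrow> (\<exists>n\<ge>1. (return_map ^^ n) z = z)"

lemma return_periodic_iff: "z \<in> triangle \<Longrightarrow> return_periodic z \<longleftrightarrow> T_periodic z"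
  unfolding return_periodic_def T_periodic_def
  by (metis return_map_pow_eq_T_pow T_pow_eq_return_map_pow order_trans)

lemma T_pow_in_unit_square: "z \<in> unit_square \<Longrightarrow> (T ^^ n) z \<in> unit_square"
  by (induction n) (auto intro: T_in_unit_square)

lemma T_pow_inj: "u \<in> unit_square \<Longrightarrow> v \<in> unit_square \<Longrightarrow> (T ^^ n) u = (T ^^ n) v \<Longrightarrow> u = v"
  by (induction n) (auto dest!: inj_onD[OF bij_betw_imp_inj_on[OF bij_betw_T]] simp: T_pow_in_unit_square)

text \<open>On the square \<open>T\<close> is injective, so an orbit that is eventually periodic is
  periodic from the start.\<close>
lemma T_periodic_backwards:
  assumes "z \<in> unit_square" "T_periodic ((T ^^ n) z)"
  shows "T_periodic z"
proof -
  obtain p where p: "p \<ge> 1" "(T ^^ p) ((T ^^ n) z) = (T ^^ n) z"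
    using assms(2) unfolding T_periodic_def by blast
  then have "(T ^^ n) ((T ^^ p) z) = (T ^^ n) z" by (metis funpow_add add.commute o_apply)
  then show ?thesis using p(1) T_pow_inj T_pow_in_unit_square assms(1) unfolding T_periodic_def by blast
qed

lemma return_periodic_backwards:
  assumes "z \<in> triangle" "return_periodic ((return_map ^^ n) z)"
  shows "return_periodic z"
  using assms return_map_pow_eq_T_pow[OF assms(1), of n] return_map_pow_in_triangle[OF assms(1), of n]
  by (metis return_periodic_iff T_periodic_backwards triangle_in_unit_square)

section \<open>Self-similarity of the return map\<close>

text \<open>Division by \<open>\<gamma>\<^sup>2\<close>. The image of the triangle is its part below the height \<open>1/\<gamma>\<^sup>2\<close>,
  called the small triangle.\<close>
fun shrink :: "real \<times> real \<Rightarrow> real \<times> real" where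
  "shrink (x, y) = ((2 - golden) * x, (2 - golden) * y)"

lemma shrink_in_triangle:
  assumes "z \<in> triangle" shows "shrink z \<in> triangle" "snd (shrink z) < 2 - golden"
proof -
  obtain x y where z: "z = (x, y)" by (cases z)
  have h: "0 \<le> x" "0 \<le> y - golden * x" "0 < y" "y < 1"
    using assms z by (auto simp: triangle_def)
  have a: "0 < 2 - golden" "2 - golden < 1" using golden_bounds by simp_all
  have lt: "(2 - golden) * y < (2 - golden) * 1" using h a by (intro mult_strict_left_mono) simp_all
  then show "snd (shrink z) < 2 - golden" using z by simp
  moreover have "0 \<le> (2 - golden) * (y - golden * x)" "0 \<le> (2 - golden) * x" "0 < (2 - golden) * y"
    using h a by simp_all
  moreover have "golden * ((2 - golden) * x) \<le> (2 - golden) * y"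
    using calculation(2) by (simp add: golden_simps)
  moreover have "(2 - golden) * y < 1" using less_trans[OF lt, of 1] a by simp
  ultimately show "shrink z \<in> triangle" using a z by (simp add: triangle_def)
qed

lemma small_triangle_eq_shrink:
  assumes "w \<in> triangle" "snd w < 2 - golden"
  obtains z where "z \<in> triangle" "w = shrink z"
proof (cases w)
  case (Pair x y)
  have h: "0 \<le> x" "0 \<le> y - golden * x" "0 < y" "0 < (golden + 1) * (2 - golden - y)"
    using assms Pair golden_bounds by (auto simp: triangle_def)
  have "0 \<le> (golden + 1) * (y - golden * x)" "0 \<le> (golden + 1) * x" "0 < (golden + 1) * y"
    using h golden_bounds by simp_all
  moreover have "(golden + 1) * y < 1" using h(4) by (simp add: golden_simps)
  moreover have "golden * ((golden + 1) * x) \<le> (golden + 1) * y"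
    using calculation(1) by (simp add: golden_simps)
  ultimately have "((golden + 1) * x, (golden + 1) * y) \<in> triangle"
    by (simp add: triangle_def)
  moreover have "w = shrink ((golden + 1) * x, (golden + 1) * y)" using Pair by (simp add: golden_simps)
  ultimately show thesis by (rule that)
qed

lemma shrink_inj: "shrink u = shrink v \<Longrightarrow> u = v"
  using golden_bounds by (cases u; cases v) auto

text \<open>The first half of the self-similarity of the return map: the shrunk point performs
  \<open>rot2\<close>, \<open>rot3\<close>, \<open>rot2\<close>, and these rotations compose to a shrunk copy of \<open>rot2\<close>. The
  low part is a triangle with the sides \<open>x = 0\<close>, \<open>y = \<gamma>x\<close>, \<open>\<gamma>y - x = 1\<close>, and each affine
  function whose sign matters is a combination of \<open>x\<close>, \<open>y - \<gamma>x\<close>, \<open>1 + x - \<gamma>y\<close> with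
  nonnegative coefficients in \<open>\<int>[\<gamma>]\<close>.\<close>
lemma shrink_return_low:
  assumes "z \<in> triangle" "low z"
  shows "(return_map ^^ 3) (shrink z) = shrink (return_map z)"
    and "0 < j \<Longrightarrow> j < 3 \<Longrightarrow> 2 - golden \<le> snd ((return_map ^^ j) (shrink z))"
proof -
  obtain x y where z: "z = (x, y)" by (cases z)
  have h: "0 \<le> x" "0 \<le> y - golden * x" "0 < y" "0 < 1 - y" "0 \<le> 1 + x - golden * y"
    using assms z by (auto simp: triangle_def)
  note f = golden_multiples[OF h(1)] golden_multiples[OF h(2)] golden_multiples[OF h(5)]
  \<comment> \<open>The slack of the strict inequality saying that \<open>?p1\<close> is high.\<close>
  have s: "0 < (golden - 1) * (1 - y)" using h golden_bounds by simp
  let ?p0 = "shrink z" let ?p1 = "rot2 ?p0" let ?p2 = "rot3 ?p1"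
  have l0: "low ?p0" using h f z by (simp add: golden_simps)
  have l1: "\<not> low ?p1" using s z by (simp add: golden_simps)
  have b1: "2 - golden \<le> snd ?p1" using h f z by (simp add: golden_simps)
  have l2: "low ?p2" using f(10) z by (simp add: golden_simps)
  have b2: "2 - golden \<le> snd ?p2" using h f z by (simp add: golden_simps)
  have e: "rot2 ?p2 = shrink (rot2 z)" using z by (simp add: golden_simps)
  show "(return_map ^^ 3) (shrink z) = shrink (return_map z)"
    using l0 l1 l2 e assms by (simp add: numeral_3_eq_3 return_map_def)
  show "2 - golden \<le> snd ((return_map ^^ j) (shrink z))" if "0 < j" "j < 3"
  proof -
    have "j = 1 \<or> j = 2" using that by auto
    then show ?thesis using l0 l1 l2 b1 b2 by (auto simp: numeral_2_eq_2 return_map_def)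
  qed
qed

text \<open>The second half: now the shrunk point performs \<open>rot2\<close>, three times \<open>rot3\<close>, and
  \<open>rot2\<close>. The sides of the high part are \<open>x = 0\<close>, \<open>y = 1\<close>, \<open>\<gamma>y - x = 1\<close>.\<close>
lemma shrink_return_high:
  assumes "z \<in> triangle" "\<not> low z"
  shows "(return_map ^^ 5) (shrink z) = shrink (return_map z)"
    and "0 < j \<Longrightarrow> j < 5 \<Longrightarrow> 2 - golden \<le> snd ((return_map ^^ j) (shrink z))"
proof -
  obtain x y where z: "z = (x, y)" by (cases z)
  have h: "0 \<le> x" "0 < y" "0 \<le> 1 - y" "0 < golden * y - x - 1"
    using assms z by (auto simp: triangle_def)
  note f = golden_multiples[OF h(1)] golden_multiples[OF h(3)] golden_multiples[OF less_imp_le[OF h(4)]]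
  have s: "0 < (2 - golden) * (golden * y - x - 1)" "0 < (golden - 1) * (1 - y)"
    using assms z h golden_bounds by (auto simp: triangle_def)
  let ?p0 = "shrink z" let ?p1 = "rot2 ?p0" let ?p2 = "rot3 ?p1"
  let ?p3 = "rot3 ?p2" let ?p4 = "rot3 ?p3"
  have l0: "low ?p0" using h f z by (simp add: golden_simps)
  have l1: "\<not> low ?p1" using s(2) z by (simp add: golden_simps)
  have b1: "2 - golden \<le> snd ?p1" using h f z by (simp add: golden_simps)
  have l2: "\<not> low ?p2" using s(1) z by (simp add: golden_simps)
  have b2: "2 - golden \<le> snd ?p2" using h f z by (simp add: golden_simps)
  have l3: "\<not> low ?p3" using s(1) h z by (simp add: golden_simps)
  have b3: "2 - golden \<le> snd ?p3" using h f z by (simp add: golden_simps)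
  have l4: "low ?p4" using f(1) z by (simp add: golden_simps)
  have b4: "2 - golden \<le> snd ?p4" using h f z by (simp add: golden_simps)
  have e: "rot2 ?p4 = shrink (rot3 z)" using z by (simp add: golden_simps)
  have g: "return_map ?p0 = ?p1" "return_map ?p1 = ?p2" "return_map ?p2 = ?p3" "return_map ?p3 = ?p4"
    "return_map ?p4 = shrink (return_map z)"
    using l0 l1 l2 l3 l4 e assms by (simp_all only: return_map_def if_True if_False)
  show "(return_map ^^ 5) (shrink z) = shrink (return_map z)"
    by (simp only: eval_nat_numeral BitM.simps funpow.simps o_apply g id_apply)
  show "2 - golden \<le> snd ((return_map ^^ j) (shrink z))" if "0 < j" "j < 5"
  proof -
    have "j = 1 \<or> j = 2 \<or> j = 3 \<or> j = 4" using that by auto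
    then show ?thesis using b1 b2 b3 b4
      by (elim disjE) (simp_all only: eval_nat_numeral BitM.simps One_nat_def funpow.simps o_apply g id_apply)
  qed
qed

text \<open>The first return to the small triangle is conjugate by \<open>shrink\<close> to the return map itself,
  and it always takes more than one step. The bound \<open>1 < k\<close> is what makes periods drop
  strictly under magnification.\<close>
lemma shrink_return:
  assumes "z \<in> triangle"
  obtains k where "1 < k" "(return_map ^^ k) (shrink z) = shrink (return_map z)"
    "\<And>j. 0 < j \<Longrightarrow> j < k \<Longrightarrow> 2 - golden \<le> snd ((return_map ^^ j) (shrink z))"
proof (cases "low z")
  case True
  then show ?thesis using that[of 3] shrink_return_low[OF assms] by simp
next
  case False
  then show ?thesis using that[of 5] shrink_return_high[OF assms] by simp
qed

text \<open>Every visit of the orbit of \<open>shrink z\<close> to the small triangle is one of the first returns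
  described by \<open>shrink_return\<close>. Hence the given visit after \<open>p\<close> steps consists of some
  \<open>q\<close> first returns, each of length at least two, and these mirror \<open>q\<close> steps of \<open>z\<close>.\<close>
lemma return_descent:
  assumes "z \<in> triangle" "v \<in> triangle" "1 \<le> p" "(return_map ^^ p) (shrink z) = shrink v"
  shows "\<exists>q\<ge>1. q < p \<and> (return_map ^^ q) z = v"
  using assms
proof (induction p arbitrary: z rule: less_induct)
  case (less p)
  obtain k where k: "1 < k" "(return_map ^^ k) (shrink z) = shrink (return_map z)"
    "\<And>j. 0 < j \<Longrightarrow> j < k \<Longrightarrow> 2 - golden \<le> snd ((return_map ^^ j) (shrink z))"
    using shrink_return[OF less.prems(1)] by blast
  \<comment> \<open>Otherwise \<open>p\<close> would be the time of a visit before the first return.\<close>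
  have "k \<le> p"
    using k(3)[of p] less.prems(3,4) shrink_in_triangle(2)[OF less.prems(2)] by force
  then have eq: "(return_map ^^ (p - k)) (shrink (return_map z)) = shrink v"
    using k(2) less.prems(4) by (metis funpow_add o_apply le_add_diff_inverse2)
  show ?case
  proof (cases "p = k")
    case True
    then have "return_map z = v" using eq by (simp add: shrink_inj)
    then show ?thesis using True k(1) by (intro exI[of _ 1]) simp
  next
    case False
    then have "p - k < p" "1 \<le> p - k" using \<open>k \<le> p\<close> k(1) by auto
    then obtain q where "q \<ge> 1" "q < p - k" "(return_map ^^ q) (return_map z) = v"
      using less.IH[OF _ return_map_in_triangle[OF less.prems(1)] less.prems(2) _ eq] by blast
    then show ?thesis using k(1) by (intro exI[of _ "Suc q"]) (auto simp: funpow_swap1)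
  qed
qed

lemma return_map_pow_shrink:
  assumes "z \<in> triangle"
  shows "\<exists>m\<ge>n. (return_map ^^ m) (shrink z) = shrink ((return_map ^^ n) z)"
proof (induction n)
  case (Suc n)
  then obtain m where m: "m \<ge> n" "(return_map ^^ m) (shrink z) = shrink ((return_map ^^ n) z)" by blast
  obtain k where "1 < k"
    "(return_map ^^ k) (shrink ((return_map ^^ n) z)) = shrink (return_map ((return_map ^^ n) z))"
    using shrink_return[OF return_map_pow_in_triangle[OF assms]] by blast
  then show ?case using m by (intro exI[of _ "k + m"]) (auto simp: funpow_add)
qed (auto intro: exI[of _ 0])

lemma return_periodic_shrink:
  assumes "z \<in> triangle" "return_periodic z" shows "return_periodic (shrink z)"
  using assms return_map_pow_shrink[OF assms(1)] unfolding return_periodic_def by (metis order_trans)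

section \<open>An aperiodic orbit on the vertical axis\<close>

lemma funpow_fixed_shift: "(f ^^ n) z = z \<Longrightarrow> (f ^^ n) ((f ^^ k) z) = (f ^^ k) z"
  by (metis funpow_add add.commute o_apply)

text \<open>The edge \<open>x = 0\<close> of the triangle is carried back to itself where it is high enough, and there
  the orbit reduces to a one-dimensional translation.\<close>
lemma axis_step:
  assumes "golden - 1 < y" "y < 1"
  shows "return_map (return_map (0, y)) = (0, y - (golden - 1))"
proof -
  have "0 < golden * (y - (golden - 1))" using assms golden_pos by simp
  then have "\<not> low (0, y)" by (simp add: golden_simps)
  moreover have "low (rot3 (0, y))" using assms by (simp add: golden_simps)
  ultimately show ?thesis by (simp add: return_map_def golden_simps)
qed

lemma axis_triangle: "0 < y \<Longrightarrow> y < 1 \<Longrightarrow> (0, y) \<in> triangle"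
  by (simp add: triangle_def)

lemma axis_descent:
  assumes "0 < y" "y < 1" "1 \<le> n" "(return_map ^^ n) (0, (2 - golden) * y) = (0, (2 - golden) * y)"
  shows "\<exists>m\<ge>1. m < n \<and> (return_map ^^ m) (0, y) = (0, y)"
  using return_descent[OF axis_triangle axis_triangle assms(3), of y y] assms by simp

text \<open>Magnifying by \<open>\<gamma>\<^sup>2\<close>, and moving down into the small triangle by \<open>axis_step\<close> whenever
  the point is above it, carries the heights on the axis around the cycle
  \<open>1/3 \<rightarrow> \<gamma>\<^sup>2/3 \<rightarrow> 2/3 \<rightarrow> 1/(3\<gamma>\<^sup>2) \<rightarrow> 1/3\<close>. Each magnification strictly shortens a
  period, so a period of \<open>(0, 1/3)\<close> would lead to a shorter one.\<close>
lemma third_not_periodic: "1 \<le> n \<Longrightarrow> (return_map ^^ n) (0, 1/3) \<noteq> (0, 1/3)"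
proof (induction n rule: less_induct)
  case (less n)
  show ?case
  proof
    assume "(return_map ^^ n) (0, 1/3) = (0, 1/3)"
    moreover
    have e1: "(1/3 :: real) = (2 - golden) * ((golden + 1) / 3)" by (simp add: golden_simps)
    ultimately obtain m1 where m1: "1 \<le> m1" "m1 < n"
      "(return_map ^^ m1) (0, (golden + 1) / 3) = (0, (golden + 1) / 3)"
      using axis_descent[of "(golden + 1) / 3" n] less.prems golden_bounds by auto
    have "return_map (return_map (0, (golden + 1) / 3)) = (0, (2 - golden) * (2/3))"
      using axis_step[of "(golden + 1) / 3"] golden_bounds by (simp add: golden_simps)
    then have "(return_map ^^ m1) (0, (2 - golden) * (2/3)) = (0, (2 - golden) * (2/3))"
      using funpow_fixed_shift[OF m1(3), of 2] by (simp add: numeral_2_eq_2)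
    then obtain m2 where m2: "1 \<le> m2" "m2 < n" "(return_map ^^ m2) (0, 2/3) = (0, 2/3)"
      using axis_descent[of "2/3" m1] m1 by auto
    \<comment> \<open>The point reached is \<open>(0, 1/(3\<gamma>\<^sup>4))\<close>; from it two magnifications lead to \<open>(0, 1/3)\<close>.\<close>
    have "return_map (return_map (0, 2/3)) =
        (0, (2 - golden) * ((2 - golden) * ((2 - golden) * ((golden + 1) / 3))))"
      using axis_step[of "2/3"] golden_bounds by (simp add: golden_simps)
    then have "return_map (return_map (0, 2/3)) = (0, (2 - golden) * ((2 - golden) * (1/3)))"
      using e1 by simp
    then have "(return_map ^^ m2) (0, (2 - golden) * ((2 - golden) * (1/3))) =
        (0, (2 - golden) * ((2 - golden) * (1/3)))"
      using funpow_fixed_shift[OF m2(3), of 2] by (simp add: numeral_2_eq_2)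
    moreover have "0 < (2 - golden) * (1/3)" "(2 - golden) * (1/3) < 1" using golden_bounds by simp_all
    ultimately obtain m3 where m3: "1 \<le> m3" "m3 < n"
      "(return_map ^^ m3) (0, (2 - golden) * (1/3)) = (0, (2 - golden) * (1/3))"
      using axis_descent[of "(2 - golden) * (1/3)" m2] m2 by auto
    then obtain m4 where "1 \<le> m4" "m4 < n" "(return_map ^^ m4) (0, 1/3) = (0, 1/3)"
      using axis_descent[of "1/3" m3] by auto
    then show False using less.IH by blast
  qed
qed

section \<open>Reaching the small triangle\<close>

lemma low_high_small:
  assumes "low z" "\<not> low (return_map z)" shows "snd z < 2 - golden"
proof (cases z)
  case (Pair x y)
  then have "0 < golden - 1 - golden * y" using assms by (simp add: return_map_def golden_simps)
  then have "0 < (golden - 1) * (golden - 1 - golden * y)" using golden_bounds by simp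
  then show ?thesis using Pair by (simp add: golden_simps)
qed

text \<open>Two consecutive applications of \<open>rot2\<close> turn \<open>(x, y)\<close> into a point of height
  \<open>1/\<gamma>\<^sup>2 + x\<close>.\<close>
lemma low_low_large:
  assumes "z \<in> triangle" "low z" "low (return_map z)"
  shows "2 - golden \<le> snd (return_map (return_map z))"
  using assms by (cases z) (simp add: return_map_def triangle_def golden_simps)

lemma high_low_small:
  assumes "z \<in> triangle" "\<not> low z" "low (return_map z)"
  shows "snd (return_map (return_map z)) < 2 - golden"
  using assms by (cases z) (simp add: return_map_def triangle_def golden_simps)

text \<open>A point outside the small triangle either runs through one and the same rotation five times, and
  is then fixed by the fifth iterate because that rotation has order five, or it enters the small
  triangle through very few itineraries: some \<open>rot3\<close> steps followed by one \<open>rot2\<close>. The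
  short itinerary matters for the height estimate below.\<close>
lemma reaches_small:
  assumes z: "z \<in> triangle" and np: "(return_map ^^ 5) z \<noteq> z" and ns: "\<not> snd z < 2 - golden"
  obtains k where "k \<le> 4" "\<And>j. j < k \<Longrightarrow> \<not> low ((return_map ^^ j) z)" "low ((return_map ^^ k) z)"
    "snd ((return_map ^^ Suc k) z) < 2 - golden"
proof (cases "low z")
  case True
  show ?thesis
  proof (cases "snd (return_map z) < 2 - golden")
    case True
    then show ?thesis using that[of 0] \<open>low z\<close> by simp
  next
    case False
    \<comment> \<open>A low point outside the small triangle is followed by another low point, and the point after
      that is outside again. So a \<open>rot2\<close> that misses the small triangle is repeated forever.\<close>
    have step: "low (return_map w) \<and> \<not> snd (return_map (return_map w)) < 2 - golden"
      if "w \<in> triangle" "low w" "\<not> snd w < 2 - golden" for w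
      using that low_high_small[of w] low_low_large[of w] by force
    have a: "low (return_map z)" "\<not> snd (return_map (return_map z)) < 2 - golden"
      using step[OF z True ns] by auto
    note b = step[OF return_map_in_triangle[OF z] a(1) False]
    have c: "low (return_map (return_map z))" using b by auto
    note d = step[OF return_map_in_triangle[OF return_map_in_triangle[OF z]] c a(2)]
    have e: "low (return_map (return_map (return_map z)))"
      "\<not> snd (return_map (return_map (return_map z))) < 2 - golden"
      using b d by auto
    have f: "low (return_map (return_map (return_map (return_map z))))"
      using step[OF return_map_in_triangle[OF return_map_in_triangle[OF return_map_in_triangle[OF z]]] e] by auto
    have "(return_map ^^ 5) z = z"
      unfolding funpow_5 using True a(1) c e(1) f rot2_pow5[of z] by (simp add: return_map_def)
    then show ?thesis using np by contradiction
  qed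
next
  case False
  show ?thesis
  proof (cases "\<exists>k\<le>4. low ((return_map ^^ k) z)")
    case True
    define k where "k = (LEAST k. low ((return_map ^^ k) z))"
    have k: "low ((return_map ^^ k) z)" unfolding k_def using True by (metis LeastI)
    have least: "\<not> low ((return_map ^^ j) z)" if "j < k" for j
      using that not_less_Least unfolding k_def by blast
    have "k \<le> 4" using True least by (meson le_trans not_le)
    \<comment> \<open>The step before the first \<open>rot2\<close> is a \<open>rot3\<close>, because the orbit starts high.\<close>
    moreover obtain i where i: "k = Suc i" using False k by (cases k) auto
    have "snd ((return_map ^^ Suc k) z) < 2 - golden"
      using high_low_small[OF return_map_pow_in_triangle[OF z, of i]] least[of i] k i by simp
    ultimately show ?thesis using that k least by blast
  next
    case no: False
    have "\<not> low ((return_map ^^ k) z)" if "k \<le> 4" for k using no that by blast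
    from this[of 0] this[of 1] this[of 2] this[of 3] this[of 4]
    have "(return_map ^^ 5) z = z"
      unfolding funpow_5 using rot3_pow5[of z] by (simp add: return_map_def eval_nat_numeral)
    then show ?thesis using np by contradiction
  qed
qed

section \<open>Heights of points with coordinates in the golden integers\<close>

text \<open>The number \<open>exp(\<pi>i/5)\<close>, given by its real part \<open>cos(\<pi>/5) = \<gamma>/2\<close>.\<close>
definition \<omega> :: complex where
  "\<omega> = Complex (golden / 2) (sqrt (1 - (golden / 2)\<^sup>2))"

lemma golden_half_square: "(golden / 2)\<^sup>2 = (golden + 1) / 4"
  by (simp add: power2_eq_square golden_simps)

lemma Re_omega: "Re \<omega> = golden / 2"
  by (simp add: \<omega>_def)

lemma Im_omega: "0.587 < Im \<omega>" "(Im \<omega>)\<^sup>2 = 1 - (golden + 1) / 4"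
proof -
  have "0.587 < sqrt (1 - (golden + 1) / 4)"
    using golden_bounds by (intro real_less_rsqrt) (simp add: power2_eq_square)
  then show "0.587 < Im \<omega>" unfolding \<omega>_def golden_half_square by simp
  show "(Im \<omega>)\<^sup>2 = 1 - (golden + 1) / 4" unfolding \<omega>_def golden_half_square
    using golden_bounds by simp
qed

lemma omega_square: "\<omega> * \<omega> = of_real golden * \<omega> - 1"
proof (rule complex_eqI)
  have "Im \<omega> * Im \<omega> = 1 - (golden + 1) / 4" using Im_omega(2) by (simp add: power2_eq_square)
  then have "Re \<omega> * Re \<omega> - Im \<omega> * Im \<omega> = golden * Re \<omega> - 1"
    by (simp only: Re_omega) (simp add: golden_square)
  then show "Re (\<omega> * \<omega>) = Re (of_real golden * \<omega> - 1)"
    by simp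
  show "Im (\<omega> * \<omega>) = Im (of_real golden * \<omega> - 1)"
    by (simp add: Re_omega)
qed

lemma norm_omega: "cmod \<omega> = 1"
  unfolding cmod_def Im_omega(2) Re_omega golden_half_square by simp

lemma norm_one_minus_omega: "cmod (1 - \<omega>) = golden - 1"
proof -
  have "(Re (1 - \<omega>))\<^sup>2 + (Im (1 - \<omega>))\<^sup>2 = (1 - golden / 2)\<^sup>2 + (Im \<omega>)\<^sup>2"
    by (simp add: Re_omega)
  also have "\<dots> = (golden - 1)\<^sup>2"
    unfolding Im_omega(2) by (simp add: power2_eq_square golden_simps)
  finally show ?thesis using golden_bounds by (simp add: cmod_def)
qed

text \<open>Galois conjugation replaces \<open>golden\<close> by \<open>1 - golden\<close> in both coordinates of a point of
  \<open>\<int>[\<gamma>]\<^sup>2\<close>. The linear part \<open>(x, y) \<mapsto> (y, -x + y/\<gamma>)\<close> of \<open>T\<close> turns into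
  \<open>(x', y') \<mapsto> (y', -x' - \<gamma>y')\<close>, which in the coordinate \<open>x' + \<omega>y'\<close> is multiplication by
  \<open>-\<omega>\<close> and therefore preserves the modulus. The height of a point is this modulus. The predicate
  bounds the height and at the same time says that the point lies in \<open>\<int>[\<gamma>]\<^sup>2\<close>.\<close>
definition height_le :: "real \<times> real \<Rightarrow> real \<Rightarrow> bool" where
  "height_le z r \<longleftrightarrow> (\<exists>(a :: int) (b :: int) (c :: int) (d :: int).
     z = (a + b * golden, c + d * golden) \<and>
     cmod (of_real (a + b * (1 - golden)) + \<omega> * of_real (c + d * (1 - golden))) \<le> r)"

lemma height_le_mono: "height_le z r \<Longrightarrow> r \<le> s \<Longrightarrow> height_le z s"
  unfolding height_le_def by (blast intro: order_trans)

lemma golden_square_complex: "complex_of_real golden * of_real golden = of_real golden + 1"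
  by (metis golden_square of_real_1 of_real_add of_real_mult)

text \<open>On the conjugate side \<open>rot2\<close> is \<open>Z \<mapsto> \<omega>\<^sup>2Z + \<omega>\<close>.\<close>
lemma height_le_rot2:
  assumes "height_le z r" shows "height_le (rot2 z) (r + 1)"
proof -
  obtain a b c d :: int where z: "z = (a + b * golden, c + d * golden)"
    and n: "cmod (of_real (a + b * (1 - golden)) + \<omega> * of_real (c + d * (1 - golden))) \<le> r"
    (is "cmod ?Z \<le> r")
    using assms unfolding height_le_def by blast
  define a' b' c' d' where "a' = d - c - a" and "b' = c - b"
    and "c' = 1 - b - d + a + c" and "d' = - a - c"
  have "rot2 z = (a' + b' * golden, c' + d' * golden)"
    by (simp add: z a'_def b'_def c'_def d'_def golden_simps)
  moreover have "of_real (a' + b' * (1 - golden)) + \<omega> * of_real (c' + d' * (1 - golden))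
      = \<omega> * \<omega> * ?Z + \<omega>"
    unfolding a'_def b'_def c'_def d'_def of_real_add of_real_mult of_real_diff of_int_add of_int_diff
      of_int_minus of_int_1 of_real_minus of_real_1
    using omega_square golden_square_complex by algebra
  moreover have "cmod (\<omega> * \<omega> * ?Z + \<omega>) \<le> r + 1"
    using norm_triangle_ineq[of "\<omega> * \<omega> * ?Z" \<omega>] n by (simp add: norm_mult norm_omega)
  ultimately show ?thesis unfolding height_le_def by metis
qed

text \<open>On the conjugate side \<open>rot3\<close> is \<open>Z \<mapsto> \<omega>(1 - \<omega>) - \<omega>\<^sup>3Z\<close>, and \<open>1 - \<omega>\<close> has the
  modulus \<open>1/\<gamma>\<close>.\<close>
lemma height_le_rot3:
  assumes "height_le z r" shows "height_le (rot3 z) (r + (golden - 1))"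
proof -
  obtain a b c d :: int where z: "z = (a + b * golden, c + d * golden)"
    and n: "cmod (of_real (a + b * (1 - golden)) + \<omega> * of_real (c + d * (1 - golden))) \<le> r"
    (is "cmod ?Z \<le> r")
    using assms unfolding height_le_def by blast
  define a' b' c' d' where "a' = 1 - b - d + a + c" and "b' = - a - c"
    and "c' = b - a - c" and "d' = 1 + a - d"
  have "rot3 z = (a' + b' * golden, c' + d' * golden)"
    by (simp add: z a'_def b'_def c'_def d'_def golden_simps)
  moreover have "of_real (a' + b' * (1 - golden)) + \<omega> * of_real (c' + d' * (1 - golden))
      = \<omega> * (1 - \<omega>) - \<omega> * \<omega> * \<omega> * ?Z"
    unfolding a'_def b'_def c'_def d'_def of_real_add of_real_mult of_real_diff of_int_add of_int_diff
      of_int_minus of_int_1 of_real_minus of_real_1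
    using omega_square golden_square_complex by algebra
  moreover have "cmod (\<omega> * (1 - \<omega>) - \<omega> * \<omega> * \<omega> * ?Z) \<le> r + (golden - 1)"
    using norm_triangle_ineq4[of "\<omega> * (1 - \<omega>)" "\<omega> * \<omega> * \<omega> * ?Z"] n
    by (simp add: norm_mult norm_omega norm_one_minus_omega)
  ultimately show ?thesis unfolding height_le_def by metis
qed

text \<open>Magnification by \<open>\<gamma>\<^sup>2\<close> is conjugate to multiplication by \<open>(1 - \<gamma>)\<^sup>2 = 1/\<gamma>\<^sup>2\<close>: it
  contracts heights.\<close>
lemma height_le_unshrink:
  assumes "height_le (shrink z) r" shows "height_le z ((2 - golden) * r)"
proof -
  obtain a b c d :: int where z: "shrink z = (a + b * golden, c + d * golden)"
    and n: "cmod (of_real (a + b * (1 - golden)) + \<omega> * of_real (c + d * (1 - golden))) \<le> r"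
    (is "cmod ?Z \<le> r")
    using assms unfolding height_le_def by blast
  define a' b' c' d' where "a' = a + b" and "b' = a + 2 * b" and "c' = c + d" and "d' = c + 2 * d"
  have "shrink (a' + b' * golden, c' + d' * golden) = shrink z"
    by (simp add: z a'_def b'_def c'_def d'_def golden_simps)
  then have "z = (a' + b' * golden, c' + d' * golden)" by (metis shrink_inj)
  moreover have "of_real (a' + b' * (1 - golden)) + \<omega> * of_real (c' + d' * (1 - golden))
      = of_real (2 - golden) * ?Z"
    unfolding a'_def b'_def c'_def d'_def of_real_add of_real_mult of_real_diff of_int_add of_int_diff
      of_int_minus of_int_1 of_int_mult of_int_numeral of_real_minus of_real_1 of_real_numeral
    using omega_square golden_square_complex by algebra
  moreover have "cmod (of_real (2 - golden) * ?Z) \<le> (2 - golden) * r"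
  proof -
    have "cmod (of_real (2 - golden)) = 2 - golden" using golden_bounds by (simp only: norm_of_real) simp
    then show ?thesis using n golden_bounds by (simp only: norm_mult) (simp add: mult_left_mono)
  qed
  ultimately show ?thesis unfolding height_le_def by metis
qed

lemma height_le_pow_high:
  assumes "height_le z r" "\<And>j. j < k \<Longrightarrow> \<not> low ((return_map ^^ j) z)"
  shows "height_le ((return_map ^^ k) z) (r + k * (golden - 1))"
  using assms(2)
proof (induction k)
  case (Suc k)
  then have "height_le ((return_map ^^ k) z) (r + k * (golden - 1))"
    "\<not> low ((return_map ^^ k) z)" by auto
  moreover have "r + k * (golden - 1) + (golden - 1) = r + Suc k * (golden - 1)"
    by (simp add: algebra_simps)
  ultimately show ?case using height_le_rot3 by (metis return_map_def comp_apply funpow.simps(2))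
qed (simp add: assms(1))

text \<open>An itinerary of \<open>reaches_small\<close> adds at most \<open>4/\<gamma> + 1 < 3.473\<close> to the height, and the
  magnification that follows divides by \<open>\<gamma>\<^sup>2\<close>.\<close>
lemma height_reduction:
  assumes z: "z \<in> triangle" and h: "height_le z r" and np: "\<not> return_periodic z"
  obtains k v where "v \<in> triangle" "(return_map ^^ k) z = shrink v"
    "height_le v ((2 - golden) * (r + 3.473))"
proof (cases "snd z < 2 - golden")
  case True
  then obtain v where v: "v \<in> triangle" "z = shrink v" using small_triangle_eq_shrink z by blast
  have "height_le z (r + 3.473)" using h by (rule height_le_mono) simp
  then show ?thesis using that[of v 0] v height_le_unshrink by simp
next
  case False
  have "(return_map ^^ 5) z \<noteq> z" using np unfolding return_periodic_def by (auto dest: spec[of _ 5])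
  then obtain k where k: "k \<le> 4" "\<And>j. j < k \<Longrightarrow> \<not> low ((return_map ^^ j) z)" "low ((return_map ^^ k) z)"
    "snd ((return_map ^^ Suc k) z) < 2 - golden"
    using reaches_small[OF z _ False] by blast
  have "height_le ((return_map ^^ Suc k) z) (r + k * (golden - 1) + 1)"
    using height_le_rot2[OF height_le_pow_high[OF h k(2)]] k(3) by (simp add: return_map_def)
  moreover have "k * (golden - 1) \<le> 4 * 0.6181"
    using k(1) golden_bounds by (intro mult_mono) simp_all
  moreover have "r + t + 1 \<le> r + 3.473" if "t \<le> 4 * 0.6181" for t :: real
    using that by simp
  ultimately have "height_le ((return_map ^^ Suc k) z) (r + 3.473)"
    using height_le_mono by blast
  moreover obtain v where "v \<in> triangle" "(return_map ^^ Suc k) z = shrink v"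
    using small_triangle_eq_shrink[OF return_map_pow_in_triangle[OF z] k(4)] by blast
  ultimately show ?thesis using that[of v "Suc k"] height_le_unshrink by simp
qed

section \<open>Periodicity of points with coordinates in the golden integers\<close>

text \<open>The difference of \<open>a + b\<gamma>\<close> and its conjugate is \<open>b\<surd>5\<close>, so the bounds leave only
  finitely many \<open>b\<close>, and \<open>a\<close> is determined by \<open>b\<close>. The next candidate \<open>2\<gamma> - 3\<close> has
  the conjugate \<open>-1 - 2\<gamma>\<close>, of absolute value above \<open>4.2\<close>.\<close>
lemma golden_integer_small:
  fixes a b :: int
  assumes "0 \<le> a + b * golden" "a + b * golden < 1" "\<bar>a + b * (1 - golden)\<bar> < 4.1"
  shows "a + b * golden \<in> {0, golden - 1, 2 - golden}"
proof -
  have diff: "b * (2 * golden - 1) = (a + b * golden) - (a + b * (1 - golden))"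
    by (simp add: algebra_simps)
  have "b < 3"
  proof (rule ccontr)
    assume "\<not> b < 3"
    then have "3 * 2.236 \<le> b * (2 * golden - 1)" using golden_bounds by (intro mult_mono) simp_all
    then show False using assms diff by simp
  qed
  moreover have "- 2 < b"
  proof (rule ccontr)
    assume "\<not> - 2 < b"
    then have "2 * 2.236 \<le> (- real_of_int b) * (2 * golden - 1)" using golden_bounds by (intro mult_mono) simp_all
    then show False using assms diff by simp
  qed
  ultimately consider "b = -1" | "b = 0" | "b = 1" | "b = 2" by linarith
  then show ?thesis
  proof cases
    case 1
    then have "1 < real_of_int a" "real_of_int a < 3" using assms golden_bounds by simp_all
    then have "a = 2" by linarith
    then show ?thesis using 1 by simp
  next
    case 2
    then have "a = 0" using assms by simp
    then show ?thesis using 2 by simp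
  next
    case 3
    then have "-2 < real_of_int a" "real_of_int a < 0" using assms golden_bounds by simp_all
    then have "a = -1" by linarith
    then show ?thesis using 3 by simp
  next
    case 4
    then have "-4 < real_of_int a" "real_of_int a < -2" using assms golden_bounds by simp_all
    then have "a = -3" by linarith
    \<comment> \<open>Here the conjugate \<open>-1 - 2\<gamma>\<close> is too large.\<close>
    then show ?thesis using 4 assms golden_bounds by simp
  qed
qed

text \<open>Both conjugate coordinates are bounded in terms of \<open>Z = x' + \<omega>y'\<close>, since
  \<open>Im Z = y' Im \<omega>\<close> and, after multiplication by the unit \<open>cnj \<omega>\<close>, the imaginary part is
  \<open>-x' Im \<omega>\<close>.\<close>
lemma small_height_points:
  assumes z: "z \<in> triangle" and h: "height_le z 2.4"
  shows "z \<in> {(0, golden - 1), (0, 2 - golden), (2 - golden, golden - 1)}"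
proof -
  obtain a b c d :: int where zz: "z = (a + b * golden, c + d * golden)"
    and n: "cmod (of_real (a + b * (1 - golden)) + \<omega> * of_real (c + d * (1 - golden))) \<le> 2.4"
    (is "cmod (of_real ?x + \<omega> * of_real ?y) \<le> _")
    using h unfolding height_le_def by blast
  have bound: "\<bar>t\<bar> < 4.1" if "\<bar>Im \<omega> * t\<bar> \<le> 2.4" for t
  proof (rule ccontr)
    assume "\<not> \<bar>t\<bar> < 4.1"
    then have "0.587 * 4.1 \<le> Im \<omega> * \<bar>t\<bar>" using Im_omega(1) by (intro mult_mono) simp_all
    then show False using that Im_omega(1) by (simp add: abs_mult)
  qed
  have "\<bar>Im (of_real ?x + \<omega> * of_real ?y)\<bar> \<le> 2.4"
    using abs_Im_le_cmod n order_trans by blast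
  then have y: "\<bar>?y\<bar> < 4.1" by (intro bound) simp
  have "cmod (cnj \<omega> * (of_real ?x + \<omega> * of_real ?y)) \<le> 2.4"
    using n by (simp only: norm_mult complex_mod_cnj norm_omega mult_1)
  then have "\<bar>Im (cnj \<omega> * (of_real ?x + \<omega> * of_real ?y))\<bar> \<le> 2.4"
    using abs_Im_le_cmod order_trans by blast
  moreover have "Im (cnj \<omega> * (of_real ?x + \<omega> * of_real ?y)) = Im \<omega> * - ?x"
    by (simp add: algebra_simps)
  ultimately have "\<bar>- ?x\<bar> < 4.1" by (intro bound) (simp only:)
  then have x: "\<bar>?x\<bar> < 4.1" by (simp only: abs_minus_cancel)
  have "z \<in> unit_square" using z by (rule triangle_in_unit_square)
  then have "fst z \<in> {0, golden - 1, 2 - golden}" "snd z \<in> {0, golden - 1, 2 - golden}"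
    using golden_integer_small[OF _ _ x] golden_integer_small[OF _ _ y] zz
    by (simp_all add: unit_square_def)
  moreover have "golden * (golden - 1) = 1" "golden * (2 - golden) = golden - 1"
    by (simp_all add: golden_simps)
  ultimately show ?thesis using z golden_bounds by (cases z) (auto simp: triangle_def)
qed

text \<open>All three lie on one cycle of length five of \<open>rot2\<close>.\<close>
lemma pentagon_points:
  assumes "z \<in> {(0, golden - 1), (0, 2 - golden), (2 - golden, golden - 1)}"
  shows "return_periodic z"
proof -
  have g: "return_map (0, golden - 1) = (2 - golden, golden - 1)"
    "return_map (2 - golden, golden - 1) = (0, 2 - golden)"
    "return_map (0, 2 - golden) = (2 * golden - 3, 4 - 2 * golden)"
    "return_map (2 * golden - 3, 4 - 2 * golden) = (2 * golden - 3, 2 - golden)"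
    "return_map (2 * golden - 3, 2 - golden) = (0, golden - 1)"
    using golden_bounds by (simp_all add: return_map_def golden_simps)
  have "(return_map ^^ 5) z = z" using assms by (auto simp only: funpow_5 g insert_iff empty_iff)
  then show ?thesis unfolding return_periodic_def by (intro exI[of _ 5]) simp
qed

text \<open>For \<open>r \<ge> 2.5\<close> the bound \<open>(r + 3.473)/\<gamma>\<^sup>2\<close> is at most \<open>r - 0.1\<close>, so repeated
  magnification brings the height down to \<open>2.4\<close> in steps of at least \<open>0.1\<close>, unless a periodic
  point is met before.\<close>
lemma height_le_imp_return_periodic:
  "z \<in> triangle \<Longrightarrow> height_le z (2.4 + real n / 10) \<Longrightarrow> return_periodic z"
proof (induction n arbitrary: z)
  case 0
  then show ?case using small_height_points pentagon_points by simp
next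
  case (Suc n)
  show ?case
  proof (rule ccontr)
    assume "\<not> return_periodic z"
    then obtain k v where v: "v \<in> triangle" "(return_map ^^ k) z = shrink v"
      "height_le v ((2 - golden) * (2.4 + Suc n / 10 + 3.473))"
      using height_reduction Suc.prems by blast
    have "(2 - golden) * (2.4 + Suc n / 10 + 3.473) \<le> 0.382 * (2.4 + Suc n / 10 + 3.473)"
      using golden_bounds by (intro mult_right_mono) simp_all
    also have "\<dots> \<le> 2.4 + n / 10" by (simp add: field_simps)
    finally have "return_periodic v" using Suc.IH v height_le_mono by blast
    then have "return_periodic z"
      using return_periodic_shrink return_periodic_backwards v Suc.prems by metis
    then show False using \<open>\<not> return_periodic z\<close> by contradiction
  qed
qed

definition golden_integer :: "real \<Rightarrow> bool" where
  "golden_integer x \<longleftrightarrow> (\<exists>(a :: int) (b :: int). x = a + b * golden)"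

text \<open>Powers of \<open>\<gamma>\<close> above the first are eliminated by \<open>\<gamma>\<^sup>2 = \<gamma> + 1\<close>.\<close>
lemma Z_golden_golden_integer: "x \<in> Z_golden \<Longrightarrow> golden_integer x"
proof -
  assume "x \<in> Z_golden"
  then obtain p :: "int poly" where x: "x = poly (map_poly of_int p) golden"
    unfolding Z_golden_def by blast
  have "golden_integer (poly (map_poly of_int p) golden)"
  proof (induction p)
    case 0
    show ?case unfolding golden_integer_def by (intro exI[of _ 0]) simp
  next
    case (pCons a p)
    then obtain b c :: int where "poly (map_poly of_int p) golden = b + c * golden"
      unfolding golden_integer_def by blast
    then have "poly (map_poly of_int (pCons a p)) golden = (a + c) + (b + c) * golden"
      using pCons by (simp add: map_poly_pCons golden_simps)
    then show ?case unfolding golden_integer_def by (metis of_int_add)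
  qed
  then show ?thesis using x by simp
qed

lemma golden_integer_T:
  assumes "golden_integer x" "golden_integer y"
  shows "golden_integer (fst (T (x, y)))" "golden_integer (snd (T (x, y)))"
proof -
  obtain a b c d :: int where xy: "x = a + b * golden" "y = c + d * golden"
    using assms unfolding golden_integer_def by blast
  show "golden_integer (fst (T (x, y)))" using assms by (simp add: T.simps)
  have "snd (T (x, y)) = (d - c - a - \<lfloor>- x + y / golden\<rfloor>) + (c - b) * golden"
    by (simp add: T.simps frac_def) (simp add: xy golden_simps)
  then show "golden_integer (snd (T (x, y)))"
    unfolding golden_integer_def by (metis of_int_diff)
qed

lemma golden_integer_height:
  assumes "golden_integer x" "golden_integer y" obtains n :: nat where "height_le (x, y) (2.4 + n / 10)"
proof -
  obtain a b c d :: int where xy: "x = a + b * golden" "y = c + d * golden"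
    using assms unfolding golden_integer_def by blast
  let ?r = "cmod (of_real (a + b * (1 - golden)) + \<omega> * of_real (c + d * (1 - golden)))"
  obtain n :: nat where "10 * ?r \<le> n" using real_arch_simple by blast
  then have "?r \<le> 2.4 + n / 10" by simp
  then have "height_le (x, y) (2.4 + n / 10)" unfolding height_le_def using xy by blast
  then show ?thesis by (rule that)
qed

lemma golden_integer_T_periodic:
  assumes z: "z \<in> unit_square" and int: "golden_integer (fst z)" "golden_integer (snd z)"
  shows "T_periodic z"
proof -
  have int_pow: "golden_integer (fst ((T ^^ n) z)) \<and> golden_integer (snd ((T ^^ n) z))" for n
  proof (induction n)
    case (Suc n)
    then show ?case using golden_integer_T[of "fst ((T ^^ n) z)" "snd ((T ^^ n) z)"] by simp
  qed (simp add: int)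
  have good: "T_periodic z" if "(T ^^ n) z = (0, 0) \<or> (T ^^ n) z \<in> triangle" for n
  proof -
    have "T_periodic ((T ^^ n) z)"
      using that
    proof
      assume "(T ^^ n) z = (0, 0)"
      then show ?thesis unfolding T_periodic_def by (intro exI[of _ 1]) (simp add: T.simps)
    next
      assume t: "(T ^^ n) z \<in> triangle"
      obtain m :: nat where "height_le ((T ^^ n) z) (2.4 + m / 10)"
        using golden_integer_height int_pow[of n] by (metis prod.collapse)
      then show ?thesis using height_le_imp_return_periodic t return_periodic_iff by blast
    qed
    then show ?thesis using T_periodic_backwards z by blast
  qed
  show ?thesis
  proof (rule ccontr)
    assume "\<not> T_periodic z"
    then have "T ((T ^^ n) z) = rot1 ((T ^^ n) z)" for n
      using good[of n] origin_or_triangle_or_rot1[OF T_pow_in_unit_square[OF z, of n]] by blast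
    from this[of 0] this[of 1] this[of 2] this[of 3] this[of 4]
    have "(T ^^ 5) z = z" unfolding funpow_5 by (simp add: eval_nat_numeral rot1_pow5)
    then show False using \<open>\<not> T_periodic z\<close> unfolding T_periodic_def by (auto dest: spec[of _ 5])
  qed
qed

theorem theorem2p5:
  "(\<forall>z \<in> (Z_golden \<inter> {0..<1}) \<times> (Z_golden \<inter> {0..<1}). period z \<noteq> \<infinity>) \<and>
   aperiodic (\<lambda>k::int. T_power k (0, 1/3))"
proof
  have period: "period z \<noteq> \<infinity> \<longleftrightarrow> T_periodic z" for z
    by (simp add: period_def T_periodic_def)
  show "\<forall>z \<in> (Z_golden \<inter> {0..<1}) \<times> (Z_golden \<inter> {0..<1}). period z \<noteq> \<infinity>"
    unfolding period by (auto intro!: golden_integer_T_periodic Z_golden_golden_integer simp: unit_square_def)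
  have "(0, 1/3) \<in> triangle" by (rule axis_triangle) simp_all
  then have "period (0, 1/3) = \<infinity>"
    using period return_periodic_iff third_not_periodic unfolding return_periodic_def by blast
  then show "aperiodic (\<lambda>k::int. T_power k (0, 1/3))"
    by (simp add: aperiodic_iff_period_infinite unit_square_def)
qed

end
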